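(* For every $n\ge1$, the number of conservative commutative residuated lattices with $n$ elements, up to isomorphism, is $$\mathbf C(n)=\frac1n\binom{2(n-1)}{n-1},$$ that is, the $(n-1)$th Catalan number.
   Context: A commutative residuated lattice is an algebra $\mathbf A=\langle A,\wedge,\vee,\cdot,\to,\mathrm e\rangle$ such that $\langle A,\wedge,\vee\rangle$ is a lattice, $\langle A,\cdot,\mathrm e\rangle$ is a commutative monoid, and $ab\le c\iff b\le a\to c$ for all $a,b,c\in A$. It is conservative if $ab\in\{a,b\}$ for all $a,b\in A$. The $k$th Catalan number ($k\ge0$) is $C_k=\frac1{k+1}\binom{2k}{k}$, so $C_0=1$. *)

theory Defs
  imports Complex_Main "HOL-Algebra.Group"
begin

record 'a crl = "'a monoid" +
  crl_meet :: "'a \<Rightarrow> 'a \<Rightarrow> 'a"  (infixl \<open>\<curlywedge>\<index>\<close> 70)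
  crl_join :: "'a \<Rightarrow> 'a \<Rightarrow> 'a"  (infixl \<open>\<curlyvee>\<index>\<close> 65)
  crl_res  :: "'a \<Rightarrow> 'a \<Rightarrow> 'a"  (infixr \<open>\<rightharpoonup>\<index>\<close> 60)

definition crl_le :: "('a, 'm) crl_scheme \<Rightarrow> 'a \<Rightarrow> 'a \<Rightarrow> bool"  (infixl \<open>\<preceq>\<index>\<close> 50)
  where "x \<preceq>\<^bsub>A\<^esub> y \<longleftrightarrow> x \<curlywedge>\<^bsub>A\<^esub> y = x"

text \<open>
  The operations are constrained only on the carrier.  The unit \<open>\<one>\<close> of the monoid is the
  constant written e in the mathematical literature; it need not be the top element.
\<close>

locale comm_residuated_lattice = comm_monoid A for A (structure) +
  assumes meet_closed: "\<lbrakk>x \<in> carrier A; y \<in> carrier A\<rbrakk> \<Longrightarrow> x \<curlywedge> y \<in> carrier A"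
    and join_closed: "\<lbrakk>x \<in> carrier A; y \<in> carrier A\<rbrakk> \<Longrightarrow> x \<curlyvee> y \<in> carrier A"
    and res_closed: "\<lbrakk>x \<in> carrier A; y \<in> carrier A\<rbrakk> \<Longrightarrow> x \<rightharpoonup> y \<in> carrier A"
    and meet_comm: "\<lbrakk>x \<in> carrier A; y \<in> carrier A\<rbrakk> \<Longrightarrow> x \<curlywedge> y = y \<curlywedge> x"
    and join_comm: "\<lbrakk>x \<in> carrier A; y \<in> carrier A\<rbrakk> \<Longrightarrow> x \<curlyvee> y = y \<curlyvee> x"
    and meet_assoc: "\<lbrakk>x \<in> carrier A; y \<in> carrier A; z \<in> carrier A\<rbrakk>
      \<Longrightarrow> (x \<curlywedge> y) \<curlywedge> z = x \<curlywedge> (y \<curlywedge> z)"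
    and join_assoc: "\<lbrakk>x \<in> carrier A; y \<in> carrier A; z \<in> carrier A\<rbrakk>
      \<Longrightarrow> (x \<curlyvee> y) \<curlyvee> z = x \<curlyvee> (y \<curlyvee> z)"
    and meet_join_absorb: "\<lbrakk>x \<in> carrier A; y \<in> carrier A\<rbrakk> \<Longrightarrow> x \<curlywedge> (x \<curlyvee> y) = x"
    and join_meet_absorb: "\<lbrakk>x \<in> carrier A; y \<in> carrier A\<rbrakk> \<Longrightarrow> x \<curlyvee> (x \<curlywedge> y) = x"
    and residuation: "\<lbrakk>x \<in> carrier A; y \<in> carrier A; z \<in> carrier A\<rbrakk>
      \<Longrightarrow> x \<otimes> y \<preceq> z \<longleftrightarrow> y \<preceq> x \<rightharpoonup> z"

locale conservative_crl = comm_residuated_lattice +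
  assumes conservative: "\<lbrakk>x \<in> carrier A; y \<in> carrier A\<rbrakk> \<Longrightarrow> x \<otimes> y \<in> {x, y}"

definition crl_iso :: "('a, 'm) crl_scheme \<Rightarrow> ('b, 'n) crl_scheme \<Rightarrow> ('a \<Rightarrow> 'b) set"
  where "crl_iso A B = {h. bij_betw h (carrier A) (carrier B) \<and> h \<one>\<^bsub>A\<^esub> = \<one>\<^bsub>B\<^esub> \<and>
    (\<forall>x\<in>carrier A. \<forall>y\<in>carrier A.
      h (x \<otimes>\<^bsub>A\<^esub> y) = h x \<otimes>\<^bsub>B\<^esub> h y \<and>
      h (x \<curlywedge>\<^bsub>A\<^esub> y) = h x \<curlywedge>\<^bsub>B\<^esub> h y \<and>
      h (x \<curlyvee>\<^bsub>A\<^esub> y) = h x \<curlyvee>\<^bsub>B\<^esub> h y \<and>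
      h (x \<rightharpoonup>\<^bsub>A\<^esub> y) = h x \<rightharpoonup>\<^bsub>B\<^esub> h y)}"

definition crl_isomorphic :: "('a, 'm) crl_scheme \<Rightarrow> ('b, 'n) crl_scheme \<Rightarrow> bool"
  where "crl_isomorphic A B \<longleftrightarrow> crl_iso A B \<noteq> {}"

text \<open>
  Every finite conservative algebra (over any type) is isomorphic to one whose carrier is a set of natural numbers (lemma
  \<open>crl_nat_copy\<close> below), so it suffices to count isomorphism classes of the latter.
\<close>

definition conservative_crls :: "nat \<Rightarrow> nat crl set"
  where "conservative_crls n =
    {A. conservative_crl A \<and> finite (carrier A) \<and> card (carrier A) = n}"

definition crl_iso_rel :: "nat \<Rightarrow> (nat crl \<times> nat crl) set"
  where "crl_iso_rel n =
    {(A, B). A \<in> conservative_crls n \<and> B \<in> conservative_crls n \<and> crl_isomorphic A B}"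

definition num_conservative_crls :: "nat \<Rightarrow> nat"
  where "num_conservative_crls n = card (conservative_crls n // crl_iso_rel n)"

definition catalan :: "nat \<Rightarrow> real"
  where "catalan k = 1 / (real k + 1) * real ((2 * k) choose k)"

lemma crl_isomorphic_refl: "crl_isomorphic A A"
proof -
  have "(\<lambda>x. x) \<in> crl_iso A A"
    by (simp add: crl_iso_def bij_betw_def)
  then show ?thesis
    unfolding crl_isomorphic_def by blast
qed

lemma crl_isomorphic_sym:
  fixes A (structure)
  assumes A: "comm_residuated_lattice A" and "crl_isomorphic A B"
  shows "crl_isomorphic B A"
proof -
  interpret comm_residuated_lattice A by (rule A)
  from assms(2) obtain h where h: "h \<in> crl_iso A B"
    unfolding crl_isomorphic_def by blast
  then have bij: "bij_betw h (carrier A) (carrier B)"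
    by (simp add: crl_iso_def)
  define g where "g = inv_into (carrier A) h"
  have gh: "g (h x) = x" if "x \<in> carrier A" for x
    using bij that by (simp add: g_def bij_betw_inv_into_left)
  have hg: "\<exists>x\<in>carrier A. y = h x" if "y \<in> carrier B" for y
    using bij that by (auto simp: bij_betw_def)
  have "g \<in> crl_iso B A"
    unfolding crl_iso_def
  proof (intro CollectI conjI ballI)
    show "bij_betw g (carrier B) (carrier A)"
      unfolding g_def by (rule bij_betw_inv_into[OF bij])
    have "h \<one> = \<one>\<^bsub>B\<^esub>"
      using h by (simp add: crl_iso_def)
    then show "g \<one>\<^bsub>B\<^esub> = \<one>"
      using gh[OF one_closed] by simp
  next
    fix x y assume "x \<in> carrier B" "y \<in> carrier B"
    then obtain a b where ab: "a \<in> carrier A" "b \<in> carrier A" "x = h a" "y = h b"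
      using hg by blast
    have pres: "h a \<otimes>\<^bsub>B\<^esub> h b = h (a \<otimes> b)" "h a \<curlywedge>\<^bsub>B\<^esub> h b = h (a \<curlywedge> b)"
      "h a \<curlyvee>\<^bsub>B\<^esub> h b = h (a \<curlyvee> b)" "h a \<rightharpoonup>\<^bsub>B\<^esub> h b = h (a \<rightharpoonup> b)"
      using h ab by (simp_all add: crl_iso_def)
    show "g (x \<otimes>\<^bsub>B\<^esub> y) = g x \<otimes> g y" "g (x \<curlywedge>\<^bsub>B\<^esub> y) = g x \<curlywedge> g y"
      "g (x \<curlyvee>\<^bsub>B\<^esub> y) = g x \<curlyvee> g y" "g (x \<rightharpoonup>\<^bsub>B\<^esub> y) = g x \<rightharpoonup> g y"
      using ab by (simp_all add: pres gh meet_closed join_closed res_closed)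
  qed
  then show ?thesis
    unfolding crl_isomorphic_def by blast
qed

lemma crl_isomorphic_trans:
  assumes "crl_isomorphic A B" "crl_isomorphic B C"
  shows "crl_isomorphic A C"
proof -
  from assms obtain h k where hk: "h \<in> crl_iso A B" "k \<in> crl_iso B C"
    unfolding crl_isomorphic_def by blast
  then have bij: "bij_betw h (carrier A) (carrier B)" "bij_betw k (carrier B) (carrier C)"
    by (simp_all add: crl_iso_def)
  have hB: "h x \<in> carrier B" if "x \<in> carrier A" for x
    using bij(1) that by (rule bij_betwE[rule_format])
  have "k \<circ> h \<in> crl_iso A C"
    using hk bij_betw_trans[OF bij] by (simp add: crl_iso_def hB)
  then show ?thesis
    unfolding crl_isomorphic_def by blast
qed

lemma equiv_crl_iso_rel: "equiv (conservative_crls n) (crl_iso_rel n)"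
proof (rule equivI)
  show "crl_iso_rel n \<subseteq> conservative_crls n \<times> conservative_crls n"
    by (auto simp: crl_iso_rel_def)
  show "refl_on (conservative_crls n) (crl_iso_rel n)"
    by (auto simp: refl_on_def crl_iso_rel_def crl_isomorphic_refl)
  show "sym (crl_iso_rel n)"
    by (auto simp: sym_def crl_iso_rel_def conservative_crls_def conservative_crl_def
        intro: crl_isomorphic_sym)
  show "trans (crl_iso_rel n)"
    by (auto simp: trans_def crl_iso_rel_def intro: crl_isomorphic_trans)
qed

lemma crl_nat_copy:
  fixes A :: "'a crl" (structure)
  assumes A: "conservative_crl A" and fin: "finite (carrier A)"
  shows "\<exists>B \<in> conservative_crls (card (carrier A)). crl_isomorphic A B"
proof -
  interpret conservative_crl A by (rule A)
  obtain h :: "'a \<Rightarrow> nat" where h: "bij_betw h (carrier A) {0..<card (carrier A)}"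
    using ex_bij_betw_finite_nat[OF fin] by blast
  define g where "g = inv_into (carrier A) h"
  have gh: "g (h x) = x" if "x \<in> carrier A" for x
    using h that by (simp add: g_def bij_betw_inv_into_left)
  have inj: "h x = h y \<longleftrightarrow> x = y" if "x \<in> carrier A" "y \<in> carrier A" for x y
    using gh that by metis
  define B :: "nat crl" where "B = \<lparr>carrier = h ` carrier A,
    monoid.mult = \<lambda>x y. h (g x \<otimes> g y), one = h \<one>, crl_meet = \<lambda>x y. h (g x \<curlywedge> g y),
    crl_join = \<lambda>x y. h (g x \<curlyvee> g y), crl_res = \<lambda>x y. h (g x \<rightharpoonup> g y)\<rparr>"
  note cl = meet_closed join_closed res_closed
  have "conservative_crl B"
    by unfold_locales
      (auto simp: B_def crl_le_def gh cl inj m_assoc meet_join_absorb join_meet_absorb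
        meet_assoc join_assoc residuation[unfolded crl_le_def] dest: conservative
        intro: m_comm meet_comm join_comm)
  moreover have "finite (carrier B)" "card (carrier B) = card (carrier A)"
    using fin h by (auto simp: B_def bij_betw_def card_image)
  moreover have "h \<in> crl_iso A B"
    using h by (auto simp: crl_iso_def B_def gh bij_betw_def)
  ultimately show ?thesis
    unfolding conservative_crls_def crl_isomorphic_def by blast
qed

end

theory Submission
  imports Defs
begin

text \<open>
  A conservative commutative product is the minimum of a total order, so a finite algebra may be
  carried by \<open>{0, \<dots>, n - 1}\<close> with product \<open>min\<close>, unit \<open>n - 1\<close> and bottom \<open>0\<close>. This chain is rigid
  and the meet and the residual are determined by the join, so isomorphism classes correspond to
  joins with neutral element \<open>0\<close> over which \<open>min\<close> distributes. Such a join satisfies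
  \<open>x \<squnion> y = min y (f x)\<close> for \<open>x \<le> y\<close>, where \<open>f x = x \<squnion> (n - 1)\<close>, and it is associative exactly
  when the intervals \<open>{x..f x}\<close> are nested. Since \<open>f 0 = n - 1\<close>, these are the descendant intervals
  of an ordered tree with \<open>n\<close> nodes numbered in preorder.
\<close>

section \<open>Catalan numbers\<close>

lemma catalan_0: "catalan 0 = 1"
  by (simp add: catalan_def)

text \<open>This is the ratio of consecutive central binomial coefficients, found by absorbing one
  factor at a time and written without division.\<close>

lemma catalan_Suc: "(real k + 2) * catalan (Suc k) = (4 * real k + 2) * catalan k"
proof -
  have central: "real (Suc k) * real ((2 * Suc k) choose Suc k) = 2 * (2 * real k + 1) * real ((2 * k) choose k)"
  proof -
    have 1: "Suc k * ((2 * Suc k) choose Suc k) = (2 * Suc k) * ((2 * k + 1) choose k)"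
      using Suc_times_binomial_eq[of "2 * k + 1" k] by (simp add: mult.commute)
    have 2: "Suc k * ((2 * k + 1) choose Suc k) = (2 * k + 1) * ((2 * k) choose k)"
      using Suc_times_binomial_eq[of "2 * k" k] by (simp add: mult.commute)
    have 3: "(2 * k + 1) choose k = (2 * k + 1) choose Suc k"
      using binomial_symmetric[of k "2 * k + 1"] by simp
    have "Suc k * ((2 * Suc k) choose Suc k) = 2 * ((2 * k + 1) * ((2 * k) choose k))"
      using 1 2 3 by (simp only: mult.assoc)
    then have "real (Suc k * ((2 * Suc k) choose Suc k)) = real (2 * ((2 * k + 1) * ((2 * k) choose k)))"
      by (simp only:)
    then show ?thesis
      by (simp only: of_nat_mult of_nat_add) simp
  qed
  have "(real k + 2) * catalan (Suc k) = real ((2 * Suc k) choose Suc k)"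
    by (simp add: catalan_def field_simps del: binomial_Suc_Suc)
  also have "\<dots> = (4 * real k + 2) * catalan k"
    using central by (simp add: catalan_def field_simps del: binomial_Suc_Suc)
  finally show ?thesis .
qed

text \<open>
  Symmetry turns the convolution weighted by the index \<open>i\<close> into \<open>n / 2\<close> times the plain one, so
  the first-order recursion for the Catalan numbers yields one for their convolution.
\<close>

lemma catalan_convolution: "(\<Sum>i\<le>n. catalan i * catalan (n - i)) = catalan (Suc n)"
proof (induction n)
  case 0
  show ?case
    using catalan_Suc[of 0] by (simp add: catalan_0)
next
  case (Suc n)
  define S where "S m = (\<Sum>i\<le>m. catalan i * catalan (m - i))" for m
  define T where "T m = (\<Sum>i\<le>m. real i * (catalan i * catalan (m - i)))" for m
  have T: "2 * T m = real m * S m" for m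
  proof -
    have "T m = (\<Sum>i\<le>m. real (m - i) * (catalan (m - i) * catalan (m - (m - i))))"
      unfolding T_def by (rule sum.reindex_bij_witness[of _ "\<lambda>i. m - i" "\<lambda>i. m - i"]) auto
    also have "\<dots> = (\<Sum>i\<le>m. real m * (catalan i * catalan (m - i)) - real i * (catalan i * catalan (m - i)))"
      by (rule sum.cong) (auto simp: of_nat_diff algebra_simps)
    also have "\<dots> = real m * S m - T m"
      by (simp add: S_def T_def sum_subtractf sum_distrib_left)
    finally show ?thesis by simp
  qed
  \<comment> \<open>The weight \<open>i + 1\<close> makes the terms shifted by one begin with
    \<open>(i + 2) * catalan (Suc i)\<close>, the left side of the recursion.\<close>
  have "T (Suc n) + S (Suc n) = (\<Sum>i\<le>Suc n. (real i + 1) * catalan i * catalan (Suc n - i))"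
    by (simp add: T_def S_def sum.distrib[symmetric] algebra_simps del: sum.atMost_Suc)
  also have "\<dots> = catalan (Suc n) + (\<Sum>i\<le>n. ((real i + 2) * catalan (Suc i)) * catalan (n - i))"
    by (subst sum.atMost_Suc_shift) (simp add: catalan_0 algebra_simps)
  also have "\<dots> = catalan (Suc n) + (\<Sum>i\<le>n. 4 * (real i * (catalan i * catalan (n - i))) + 2 * (catalan i * catalan (n - i)))"
    by (simp only: catalan_Suc) (simp add: algebra_simps)
  also have "\<dots> = catalan (Suc n) + 4 * T n + 2 * S n"
    by (simp add: T_def S_def sum.distrib sum_distrib_left)
  finally have "(real n + 3) * S (Suc n) = 2 * catalan (Suc n) + 4 * (real n + 1) * S n"
    using T[of n] T[of "Suc n"] by (simp add: algebra_simps)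
  also have "\<dots> = (4 * real (Suc n) + 2) * catalan (Suc n)"
    using Suc.IH by (simp add: S_def algebra_simps)
  also have "\<dots> = (real n + 3) * catalan (Suc (Suc n))"
    using catalan_Suc[of "Suc n"] by (simp add: algebra_simps)
  finally show ?case
    by (simp add: S_def)
qed

section \<open>Forests as nested intervals\<close>

text \<open>
  Number the nodes of an ordered forest in preorder; \<open>f x\<close> is the last descendant of \<open>x\<close>.
\<close>

definition nested :: "nat \<Rightarrow> (nat \<Rightarrow> nat) \<Rightarrow> bool"
  where "nested n f \<longleftrightarrow> (\<forall>x<n. x \<le> f x \<and> f x < n \<and> (\<forall>y. x \<le> y \<and> y \<le> f x \<longrightarrow> f y \<le> f x))"

text \<open>The lists record the numbers \<open>f i - i\<close> of proper descendants, which are invariant under shifts.\<close>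

definition forests :: "nat \<Rightarrow> nat list set"
  where "forests n = {d. length d = n \<and> nested n (\<lambda>i. i + d ! i)}"

lemma forests_0: "forests 0 = {[]}"
  by (auto simp: forests_def nested_def)

lemma nestedD:
  assumes "nested n f" "x < n"
  shows "x \<le> f x" "f x < n" "\<And>y. x \<le> y \<Longrightarrow> y \<le> f x \<Longrightarrow> f y \<le> f x"
  using assms unfolding nested_def by blast+

text \<open>Grafting: \<open>ys\<close> lists the nodes below a new first root, \<open>zs\<close>
  the trees after it. Entries count descendants, so both lists are reused unshifted.\<close>

lemma Cons_append_in_forests:
  assumes ys: "ys \<in> forests k" and zs: "zs \<in> forests l"
  shows "k # ys @ zs \<in> forests (Suc (k + l))"
proof -
  have l: "length ys = k" "length zs = l"
    using ys zs by (auto simp: forests_def)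
  define f where "f i = i + (k # ys @ zs) ! i" for i
  have f0: "f 0 = k" by (simp add: f_def)
  have fy: "f (Suc i) = Suc (i + ys ! i)" if "i < k" for i
    using that l by (simp add: f_def nth_append)
  have fz: "f (Suc (k + i)) = Suc (k + (i + zs ! i))" for i
    using l by (simp add: f_def nth_append)
  have ny: "nested k (\<lambda>i. i + ys ! i)" and nz: "nested l (\<lambda>i. i + zs ! i)"
    using ys zs by (auto simp: forests_def)
  have "nested (Suc (k + l)) f"
    unfolding nested_def
  proof (intro allI impI)
    fix x assume "x < Suc (k + l)"
    \<comment> \<open>Node 0 is the new root; the nodes of \<open>ys\<close> move by one, those of
      \<open>zs\<close> by \<open>k + 1\<close>.\<close>
    then consider "x = 0" | i where "x = Suc i" "i < k" | i where "x = Suc (k + i)" "i < l"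
      by (metis add_Suc_right less_Suc_eq_0_disj nat_add_left_cancel_less le_Suc_ex not_le)
    then show "x \<le> f x \<and> f x < Suc (k + l) \<and> (\<forall>y. x \<le> y \<and> y \<le> f x \<longrightarrow> f y \<le> f x)"
    proof cases
      case 1
      have "f y \<le> k" if "y \<le> k" for y
      proof (cases y)
        case 0
        then show ?thesis by (simp add: f0)
      next
        case (Suc i)
        then show ?thesis
          using that fy[of i] nestedD(2)[OF ny, of i] by simp
      qed
      then show ?thesis
        using 1 f0 by simp
    next
      case 2
      have "f y \<le> f x" if y: "x \<le> y" "y \<le> f x" for y
      proof -
        obtain j where j: "y = Suc j" "i \<le> j" using y 2 by (metis Suc_le_D Suc_le_mono)
        have "j \<le> i + ys ! i" using y 2 j fy by simp
        then show ?thesis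
          using 2 j fy[of i] fy[of j] nestedD(2,3)[OF ny, of i] by fastforce
      qed
      then show ?thesis
        using 2 fy[of i] nestedD(2)[OF ny, of i] by simp
    next
      case 3
      have "f y \<le> f x" if y: "x \<le> y" "y \<le> f x" for y
      proof -
        obtain j where j: "y = Suc (k + j)" "i \<le> j"
          using that[of "y - Suc k"] y 3 by simp
        have "j \<le> i + zs ! i" using y 3 j fz by simp
        then show ?thesis
          using 3 j fz[of i] fz[of j] nestedD(3)[OF nz, of i] by simp
      qed
      then show ?thesis
        using 3 fz[of i] nestedD(2)[OF nz, of i] by simp
    qed
  qed
  then show ?thesis
    using l by (simp add: forests_def f_def[abs_def])
qed

text \<open>The first entry \<open>k\<close> counts the nodes below the first root, so cutting the
  remaining list after \<open>k\<close> entries separates its subtrees from the later trees.\<close>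

lemma forests_SucE:
  assumes "d \<in> forests (Suc m)"
  obtains k ys zs where "k \<le> m" "d = k # ys @ zs" "ys \<in> forests k" "zs \<in> forests (m - k)"
proof -
  have "length d = Suc m" and nest: "nested (Suc m) (\<lambda>i. i + d ! i)"
    using assms by (auto simp: forests_def)
  then obtain k es where d: "d = k # es" "length es = m"
    by (metis length_Suc_conv)
  define ys where "ys = take k es"
  define zs where "zs = drop k es"
  have k: "k \<le> m" using nestedD(2)[OF nest, of 0] d by simp
  have es: "i \<le> i + es ! i \<and> i + es ! i < m \<and> (\<forall>j. i \<le> j \<and> j \<le> i + es ! i \<longrightarrow> j + es ! j \<le> i + es ! i)"
    if "i < m" for i
  proof (intro conjI allI impI)
    show "i \<le> i + es ! i" by simp
    show "i + es ! i < m"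
      using nestedD(2)[OF nest, of "Suc i"] that d by simp
    show "j + es ! j \<le> i + es ! i" if "i \<le> j \<and> j \<le> i + es ! i" for j
      using nestedD(3)[OF nest, of "Suc i" "Suc j"] that \<open>i < m\<close> d by simp
  qed
  \<comment> \<open>Nestedness at the root: no interval starting among its \<open>k\<close>
    descendants crosses the cut.\<close>
  have low: "i + es ! i < k" if "i < k" for i
    using nestedD(3)[OF nest, of 0 "Suc i"] that d by simp
  have "ys \<in> forests k"
  proof -
    have "j + ys ! j \<le> i + ys ! i" if "i < k" "i \<le> j" "j \<le> i + ys ! i" for i j
      using es[of i] low[of i] that k by (simp add: ys_def)
    then show ?thesis
      using low k d by (simp add: forests_def nested_def ys_def)
  qed
  moreover have "zs \<in> forests (m - k)"
  proof -
    have "i + es ! (k + i) < m - k \<and> (\<forall>j. i \<le> j \<and> j \<le> i + es ! (k + i) \<longrightarrow> j + es ! (k + j) \<le> i + es ! (k + i))"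
      if "i < m - k" for i
    proof -
      have "k + i < m" using that by simp
      from es[OF this] show ?thesis
        by (auto dest: spec[where x="k + _"])
    qed
    then show ?thesis
      using k d by (auto simp: forests_def nested_def zs_def)
  qed
  ultimately show thesis
    using that[of k ys zs] k d by (simp add: ys_def zs_def)
qed

lemma forests_Suc:
  "forests (Suc m) = (\<Union>k\<le>m. (\<lambda>(ys, zs). k # ys @ zs) ` (forests k \<times> forests (m - k)))"
proof (intro equalityI subsetI)
  fix d assume "d \<in> forests (Suc m)"
  then show "d \<in> (\<Union>k\<le>m. (\<lambda>(ys, zs). k # ys @ zs) ` (forests k \<times> forests (m - k)))"
    by (rule forests_SucE) force
next
  fix d assume "d \<in> (\<Union>k\<le>m. (\<lambda>(ys, zs). k # ys @ zs) ` (forests k \<times> forests (m - k)))"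
  then show "d \<in> forests (Suc m)"
    using Cons_append_in_forests by fastforce
qed

lemma finite_forests: "finite (forests m)"
proof (induction m rule: less_induct)
  case (less m)
  show ?case
    by (cases m) (auto simp: forests_0 forests_Suc less)
qed

lemma card_forests: "real (card (forests m)) = catalan m"
proof (induction m rule: less_induct)
  case (less m)
  show ?case
  proof (cases m)
    case 0
    then show ?thesis by (simp add: forests_0 catalan_0)
  next
    case (Suc l)
    let ?F = "\<lambda>k. (\<lambda>(ys, zs). k # ys @ zs) ` (forests k \<times> forests (l - k))"
    \<comment> \<open>Lists in \<open>forests k\<close> have length \<open>k\<close>, so the append
      splits uniquely; across different \<open>k\<close> the heads differ.\<close>
    have inj: "inj_on (\<lambda>(ys, zs). k # ys @ zs) (forests k \<times> forests (l - k))" for k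
      by (auto simp: inj_on_def forests_def)
    have "card (forests m) = (\<Sum>k\<le>l. card (?F k))"
      unfolding Suc forests_Suc
      by (rule card_UN_disjoint) (auto simp: finite_forests)
    also have "\<dots> = (\<Sum>k\<le>l. card (forests k) * card (forests (l - k)))"
      by (simp add: card_image[OF inj] card_cartesian_product)
    finally have "real (card (forests m)) = (\<Sum>k\<le>l. catalan k * catalan (l - k))"
      using less Suc by simp
    then show ?thesis
      by (simp add: catalan_convolution Suc)
  qed
qed

section \<open>Joins over which the minimum distributes\<close>

text \<open>\<open>J\<close> is the join of an order with least element 0, namely
  \<open>J x y = y\<close>, which in general is not the numerical order. With \<open>min\<close> as
  product, \<open>min_distrib\<close> is what residuation demands.\<close>

locale min_join =
  fixes n :: nat and J :: "nat \<Rightarrow> nat \<Rightarrow> nat"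
  assumes pos: "0 < n"
    and closed: "\<lbrakk>x < n; y < n\<rbrakk> \<Longrightarrow> J x y < n"
    and comm: "\<lbrakk>x < n; y < n\<rbrakk> \<Longrightarrow> J x y = J y x"
    and assoc: "\<lbrakk>x < n; y < n; z < n\<rbrakk> \<Longrightarrow> J (J x y) z = J x (J y z)"
    and idem: "x < n \<Longrightarrow> J x x = x"
    and zero: "x < n \<Longrightarrow> J 0 x = x"
    and min_distrib: "\<lbrakk>x < n; y < n; z < n\<rbrakk> \<Longrightarrow> min x (J y z) = J (min x y) (min x z)"

section \<open>Joins built from nested intervals\<close>

definition nested_join :: "(nat \<Rightarrow> nat) \<Rightarrow> nat \<Rightarrow> nat \<Rightarrow> nat"
  where "nested_join f x y = min (max x y) (f (min x y))"

text \<open>In the tree, the join of \<open>x\<close> with a later node \<open>y\<close> is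
  \<open>y\<close> if \<open>y\<close> descends from \<open>x\<close>, and otherwise the last
  descendant of \<open>x\<close>.\<close>

lemma nested_joinI: "x \<le> y \<Longrightarrow> nested_join f x y = min y (f x)"
  "x \<le> y \<Longrightarrow> nested_join f y x = min y (f x)"
  by (simp_all add: nested_join_def max_def min_def)

text \<open>If \<open>y\<close> lies in the interval of \<open>x\<close>, nestedness gives
  \<open>f y \<le> f x\<close>; otherwise the minimum is \<open>f x\<close>, which is its own last
  descendant.\<close>

lemma nested_min:
  assumes f: "nested n f" and "x \<le> y" "y < n"
  shows "f (min y (f x)) = min (f y) (f x)"
proof (cases "y \<le> f x")
  case True
  then show ?thesis
    using nestedD(3)[OF f, of x y] assms by simp
next
  case False
  have "f (f x) = f x"
    using nestedD[OF f, of x] nestedD(1)[OF f, of "f x"] assms by (simp add: le_antisym)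
  moreover have "y \<le> f y"
    using nestedD(1)[OF f] assms by simp
  ultimately show ?thesis
    using False by simp
qed

text \<open>Commutativity reduces associativity for arguments in any order to these three
  bracketings of a sorted triple, which share one value.\<close>

lemma nested_join_assoc_sorted:
  assumes f: "nested n f" and "x \<le> y" "y \<le> z" "z < n"
  shows "nested_join f (nested_join f x y) z = min z (min (f x) (f y))"
    "nested_join f x (nested_join f y z) = min z (min (f x) (f y))"
    "nested_join f (nested_join f x z) y = min z (min (f x) (f y))"
proof -
  have le: "x \<le> f x" "y \<le> f y" "z \<le> f z"
    using nestedD(1)[OF f] assms by auto
  have fxy: "f (min y (f x)) = min (f y) (f x)"
    using nested_min[OF f] assms by simp
  show "nested_join f (nested_join f x y) z = min z (min (f x) (f y))"
    using assms fxy by (simp add: nested_joinI min.commute)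
  show "nested_join f x (nested_join f y z) = min z (min (f x) (f y))"
    using assms le by (simp add: nested_joinI ac_simps)
  show "nested_join f (nested_join f x z) y = min z (min (f x) (f y))"
  proof (cases "y \<le> f x")
    case True
    then show ?thesis
      using assms by (simp add: nested_joinI ac_simps)
  next
    \<comment> \<open>Here the join of \<open>x\<close> and \<open>z\<close> is \<open>f x\<close>,
      which comes before \<open>y\<close>, so the outer arguments change order.\<close>
    case False
    then have "f (f x) = min (f y) (f x)" "f x \<le> y" "min z (f x) = f x"
      using fxy assms by auto
    then show ?thesis
      using assms False le by (simp add: nested_joinI ac_simps)
  qed
qed

lemma nested_join_commute: "nested_join f x y = nested_join f y x"
  by (simp add: nested_join_def ac_simps)

lemma nested_join_assoc:
  assumes f: "nested n f" and "x < n" "y < n" "z < n"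
  shows "nested_join f (nested_join f x y) z = nested_join f x (nested_join f y z)"
proof -
  note sorted = nested_join_assoc_sorted[OF f]
  consider "x \<le> y \<and> y \<le> z" | "x \<le> z \<and> z \<le> y" | "y \<le> x \<and> x \<le> z"
    | "y \<le> z \<and> z \<le> x" | "z \<le> x \<and> x \<le> y" | "z \<le> y \<and> y \<le> x"
    by linarith
  then show ?thesis
    using assms(2-4) sorted[of x y z] sorted[of x z y] sorted[of y x z] sorted[of y z x]
      sorted[of z x y] sorted[of z y x]
    by cases (simp_all add: nested_join_commute ac_simps)
qed

lemma min_join_nested_join:
  assumes f: "nested n f" and pos: "0 < n" and f0: "f 0 = n - 1"
  shows "min_join n (nested_join f)"
proof
  show "nested_join f x y < n" if "x < n" "y < n" for x y
    using that by (simp add: nested_join_def)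
  show "nested_join f (nested_join f x y) z = nested_join f x (nested_join f y z)"
    if "x < n" "y < n" "z < n" for x y z
    using nested_join_assoc[OF f] that by simp
  show "nested_join f x x = x" if "x < n" for x
    using nestedD(1)[OF f] that by (simp add: nested_join_def)
  show "nested_join f 0 x = x" if "x < n" for x
    using that f0 by (simp add: nested_join_def)
  \<comment> \<open>For \<open>x \<le> y\<close> both sides are \<open>x\<close>, since
    \<open>f\<close> lies above the identity; for \<open>y < x\<close> both are the minimum of
    \<open>x\<close>, \<open>z\<close> and \<open>f y\<close>.\<close>
  have dist: "min x (nested_join f y z) = nested_join f (min x y) (min x z)"
    if "x < n" "y \<le> z" "z < n" for x y z
  proof -
    have "x \<le> f x" "y \<le> f y" using nestedD(1)[OF f] that by auto
    moreover have "min x y \<le> min x z" using that by simp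
    ultimately show ?thesis
      using that by (auto simp: nested_joinI min_def)
  qed
  show "min x (nested_join f y z) = nested_join f (min x y) (min x z)"
    if "x < n" "y < n" "z < n" for x y z
    using dist[of x y z] dist[of x z y] that by (metis nested_join_commute nat_le_linear)
qed (auto simp: pos nested_join_commute)

section \<open>Recovering the nested intervals from a join\<close>

context min_join
begin

definition last_desc :: "nat \<Rightarrow> nat"
  where "last_desc x = J x (n - 1)"

lemma top_less: "n - 1 < n"
  using pos by simp

text \<open>Distribute \<open>min y\<close> over the join of \<open>x\<close> with
  \<open>n - 1\<close>: joins with the largest number determine all joins.\<close>

lemma J_eq:
  assumes "x \<le> y" "y < n"
  shows "J x y = min y (last_desc x)"
proof -
  have "min y x = x" "min y (n - 1) = y" using assms by auto
  then show ?thesis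
    using min_distrib[of y x "n - 1"] assms top_less by (simp add: last_desc_def)
qed

lemma J_eq_nested_join:
  assumes "x < n" "y < n"
  shows "J x y = nested_join last_desc x y"
  using J_eq[of x y] J_eq[of y x] comm[of x y] assms
  by (cases "x \<le> y") (auto simp: nested_joinI)

lemma last_desc_ge: "x < n \<Longrightarrow> x \<le> last_desc x"
  using J_eq[of x x] idem[of x] by (metis min.cobounded2 order_refl)

lemma nested_last_desc: "nested n last_desc"
  unfolding nested_def
proof (intro allI impI conjI)
  fix x assume x: "x < n"
  show "x \<le> last_desc x" using last_desc_ge x by simp
  show less: "last_desc x < n" using closed x top_less by (simp add: last_desc_def)
  fix y assume y: "x \<le> y \<and> y \<le> last_desc x"
  then have yn: "y < n" using less by simp
  \<comment> \<open>As \<open>y\<close> lies in the interval of \<open>x\<close>,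
    \<open>J x y = y\<close>. Associativity then exhibits \<open>last_desc y\<close> as a join with
    \<open>x\<close>, which is cut at \<open>last_desc x\<close>.\<close>
  have "last_desc y = J (J x y) (n - 1)"
    using J_eq[of x y] y yn by (simp add: last_desc_def)
  also have "\<dots> = J x (last_desc y)"
    using assoc x yn top_less by (simp add: last_desc_def)
  also have "\<dots> = min (last_desc y) (last_desc x)"
    using J_eq[of x "last_desc y"] last_desc_ge[OF yn] y closed[OF yn top_less, folded last_desc_def] by simp
  finally show "last_desc y \<le> last_desc x" by simp
qed

lemma last_desc_0: "last_desc 0 = n - 1"
  using zero top_less by (simp add: last_desc_def)

section \<open>The residuated lattice of a join\<close>

lemma finite_upper:
  assumes "finite F" "F \<noteq> {}" "F \<subseteq> S" "S \<subseteq> {..<n}"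
    and "\<And>x y. x \<in> S \<Longrightarrow> y \<in> S \<Longrightarrow> J x y \<in> S"
  shows "\<exists>m\<in>S. \<forall>s\<in>F. J s m = m"
  using assms(1-3)
proof (induction F rule: finite_ne_induct)
  case (singleton x)
  then show ?case using idem assms(4) by auto
next
  \<comment> \<open>Only \<open>F\<close> grows while \<open>S\<close> stays fixed, so the new bound
    \<open>J x m\<close> remains in \<open>S\<close>. The case \<open>F = S\<close> yields a
    greatest element.\<close>
  case (insert x F)
  then obtain m where m: "m \<in> S" "\<forall>s\<in>F. J s m = m" by auto
  have n: "x < n" "m < n" "s < n" if "s \<in> F" for s
    using insert.prems assms(4) m that by auto
  have xm: "x < n" "m < n"
    using insert.prems assms(4) m by auto
  have "J x (J x m) = J x m"
    using assoc[of x x m] idem xm by simp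
  moreover have "J s (J x m) = J x m" if "s \<in> F" for s
    using m that assoc comm n[OF that] closed by metis
  ultimately show ?case
    using assms(5)[of x m] m insert.prems by auto
qed

text \<open>Greatest in the order of \<open>J\<close>, not numerically.\<close>

definition greatest :: "nat set \<Rightarrow> nat"
  where "greatest S = (THE m. m \<in> S \<and> (\<forall>s\<in>S. J s m = m))"

lemma greatest:
  assumes S: "S \<subseteq> {..<n}" "0 \<in> S" "\<And>x y. x \<in> S \<Longrightarrow> y \<in> S \<Longrightarrow> J x y \<in> S"
  shows "greatest S \<in> S" "\<And>s. s \<in> S \<Longrightarrow> J s (greatest S) = greatest S"
proof -
  obtain m where m: "m \<in> S" "\<forall>s\<in>S. J s m = m"
    using finite_upper[of S S] S finite_subset[OF S(1)] by auto
  have "greatest S = m"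
    unfolding greatest_def
  proof (rule the_equality)
    fix k assume "k \<in> S \<and> (\<forall>s\<in>S. J s k = k)"
    then show "k = m" using m comm S(1) by (metis lessThan_iff subsetD)
  qed (use m in blast)
  then show "greatest S \<in> S" "\<And>s. s \<in> S \<Longrightarrow> J s (greatest S) = greatest S"
    using m by auto
qed

text \<open>The greatest elements exist because both sets contain 0 and are closed under
  \<open>J\<close>: one holds the common lower bounds, the other the solutions of the residuation
  inequality.\<close>

definition crl :: "nat crl"
  where "crl = \<lparr>carrier = {..<n}, monoid.mult = min, one = n - 1,
    crl_meet = \<lambda>x y. greatest {z. z < n \<and> J z x = x \<and> J z y = y}, crl_join = J,
    crl_res = \<lambda>x y. greatest {z. z < n \<and> J (min x z) y = y}\<rparr>"

lemma J_le_trans: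
  assumes "x < n" "y < n" "z < n" "J x y = y" "J y z = z"
  shows "J x z = z"
  using assms assoc by metis

lemma J_upper: "x < n \<Longrightarrow> y < n \<Longrightarrow> J x (J x y) = J x y"
  "x < n \<Longrightarrow> y < n \<Longrightarrow> J y (J x y) = J x y"
  using assoc comm idem by metis+

lemma J_least:
  "\<lbrakk>x < n; y < n; z < n; J x z = z; J y z = z\<rbrakk> \<Longrightarrow> J (J x y) z = z"
  using assoc by simp

lemma meet_crl:
  assumes "x < n" "y < n"
  shows "x \<curlywedge>\<^bsub>crl\<^esub> y < n" "J (x \<curlywedge>\<^bsub>crl\<^esub> y) x = x" "J (x \<curlywedge>\<^bsub>crl\<^esub> y) y = y"
    "\<And>z. \<lbrakk>z < n; J z x = x; J z y = y\<rbrakk> \<Longrightarrow> J z (x \<curlywedge>\<^bsub>crl\<^esub> y) = x \<curlywedge>\<^bsub>crl\<^esub> y"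
proof -
  let ?S = "{z. z < n \<and> J z x = x \<and> J z y = y}"
  have "?S \<subseteq> {..<n}" "0 \<in> ?S" "\<And>u v. u \<in> ?S \<Longrightarrow> v \<in> ?S \<Longrightarrow> J u v \<in> ?S"
    using assms pos zero J_least closed by auto
  note g = greatest[OF this]
  show "x \<curlywedge>\<^bsub>crl\<^esub> y < n" "J (x \<curlywedge>\<^bsub>crl\<^esub> y) x = x" "J (x \<curlywedge>\<^bsub>crl\<^esub> y) y = y"
    "\<And>z. \<lbrakk>z < n; J z x = x; J z y = y\<rbrakk> \<Longrightarrow> J z (x \<curlywedge>\<^bsub>crl\<^esub> y) = x \<curlywedge>\<^bsub>crl\<^esub> y"
    using g(1) g(2) by (simp_all add: crl_def)
qed

lemma res_crl:
  assumes "x < n" "y < n"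
  shows "x \<rightharpoonup>\<^bsub>crl\<^esub> y < n"
    "\<And>z. z < n \<Longrightarrow> J (min x z) y = y \<longleftrightarrow> J z (x \<rightharpoonup>\<^bsub>crl\<^esub> y) = x \<rightharpoonup>\<^bsub>crl\<^esub> y"
proof -
  let ?S = "{z. z < n \<and> J (min x z) y = y}"
  \<comment> \<open>The residual exists because distributivity of \<open>min\<close> closes the
    solution set under joins.\<close>
  have cl: "J u v \<in> ?S" if "u \<in> ?S" "v \<in> ?S" for u v
  proof -
    have "min x (J u v) = J (min x u) (min x v)"
      using min_distrib that assms by simp
    then show ?thesis
      using that assms J_least[of "min x u" "min x v" y] closed by simp
  qed
  have "?S \<subseteq> {..<n}" "0 \<in> ?S"
    using assms pos zero by auto
  note g = greatest[OF this cl]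
  then show r: "x \<rightharpoonup>\<^bsub>crl\<^esub> y < n"
    by (simp add: crl_def)
  show "J (min x z) y = y \<longleftrightarrow> J z (x \<rightharpoonup>\<^bsub>crl\<^esub> y) = x \<rightharpoonup>\<^bsub>crl\<^esub> y" if z: "z < n" for z
  proof
    assume "J (min x z) y = y"
    then show "J z (x \<rightharpoonup>\<^bsub>crl\<^esub> y) = x \<rightharpoonup>\<^bsub>crl\<^esub> y"
      using g(2)[of z] z by (simp add: crl_def)
  next
    assume "J z (x \<rightharpoonup>\<^bsub>crl\<^esub> y) = x \<rightharpoonup>\<^bsub>crl\<^esub> y"
    \<comment> \<open>Distributivity makes \<open>min x\<close> monotone in the order of
      \<open>J\<close>, so \<open>z\<close> inherits the inequality from the greatest
      solution.\<close>
    then have "J (min x z) (min x (x \<rightharpoonup>\<^bsub>crl\<^esub> y)) = min x (x \<rightharpoonup>\<^bsub>crl\<^esub> y)"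
      using min_distrib[of x z "x \<rightharpoonup>\<^bsub>crl\<^esub> y"] assms z r by simp
    moreover have "J (min x (x \<rightharpoonup>\<^bsub>crl\<^esub> y)) y = y"
      using g(1) by (simp add: crl_def)
    ultimately show "J (min x z) y = y"
      using J_le_trans[of "min x z" "min x (x \<rightharpoonup>\<^bsub>crl\<^esub> y)" y] assms z r by simp
  qed
qed

lemma le_crl:
  assumes "x < n" "y < n"
  shows "x \<preceq>\<^bsub>crl\<^esub> y \<longleftrightarrow> J x y = y"
proof
  show "x \<preceq>\<^bsub>crl\<^esub> y \<Longrightarrow> J x y = y"
    using meet_crl(3)[OF assms] by (simp add: crl_le_def)
  assume "J x y = y"
  then have "J x (x \<curlywedge>\<^bsub>crl\<^esub> y) = x \<curlywedge>\<^bsub>crl\<^esub> y"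
    using meet_crl(4)[OF assms assms(1)] idem assms by simp
  then show "x \<preceq>\<^bsub>crl\<^esub> y"
    using meet_crl(1,2)[OF assms] comm assms by (simp add: crl_le_def)
qed

lemma J_antisym: "x < n \<Longrightarrow> y < n \<Longrightarrow> J x y = y \<Longrightarrow> J y x = x \<Longrightarrow> x = y"
  using comm by metis

lemma conservative_crl_crl: "conservative_crl crl"
proof unfold_locales
  have sel: "carrier crl = {..<n}" "x \<otimes>\<^bsub>crl\<^esub> y = min x y" "\<one>\<^bsub>crl\<^esub> = n - 1"
    "x \<curlyvee>\<^bsub>crl\<^esub> y = J x y" for x y
    by (auto simp: crl_def)
  note sel [simp]
  note m = meet_crl
  show "\<one>\<^bsub>crl\<^esub> \<in> carrier crl"
    using pos by simp
  fix x assume x: "x \<in> carrier crl"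
  then show "\<one>\<^bsub>crl\<^esub> \<otimes>\<^bsub>crl\<^esub> x = x" "x \<otimes>\<^bsub>crl\<^esub> \<one>\<^bsub>crl\<^esub> = x"
    by auto
  fix y assume y: "y \<in> carrier crl"
  have xy': "x < n" "y < n" using x y by auto
  show "x \<otimes>\<^bsub>crl\<^esub> y \<in> carrier crl" "x \<otimes>\<^bsub>crl\<^esub> y = y \<otimes>\<^bsub>crl\<^esub> x" "x \<otimes>\<^bsub>crl\<^esub> y \<in> {x, y}"
    using xy' by (auto simp: min_def)
  show "x \<curlyvee>\<^bsub>crl\<^esub> y \<in> carrier crl" "x \<curlyvee>\<^bsub>crl\<^esub> y = y \<curlyvee>\<^bsub>crl\<^esub> x"
    using xy' closed comm by auto
  show "x \<curlywedge>\<^bsub>crl\<^esub> y \<in> carrier crl" "x \<rightharpoonup>\<^bsub>crl\<^esub> y \<in> carrier crl"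
    using m(1)[OF xy'] res_crl(1)[OF xy'] by auto
  show "x \<curlywedge>\<^bsub>crl\<^esub> y = y \<curlywedge>\<^bsub>crl\<^esub> x"
    using J_antisym[OF m(1)[OF xy'] m(1)[OF xy'(2,1)]] m(2-4)[OF xy'] m(2-4)[OF xy'(2,1)]
      m(1)[OF xy'] m(1)[OF xy'(2,1)] by simp
  show "x \<curlywedge>\<^bsub>crl\<^esub> (x \<curlyvee>\<^bsub>crl\<^esub> y) = x"
    using le_crl[of x "J x y"] xy' closed J_upper by (simp add: crl_le_def)
  show "x \<curlyvee>\<^bsub>crl\<^esub> (x \<curlywedge>\<^bsub>crl\<^esub> y) = x"
    using m(1,2)[OF xy'] comm xy' by simp
  fix z assume z: "z \<in> carrier crl"
  then have z': "z < n" by simp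
  show "x \<otimes>\<^bsub>crl\<^esub> y \<otimes>\<^bsub>crl\<^esub> z = x \<otimes>\<^bsub>crl\<^esub> (y \<otimes>\<^bsub>crl\<^esub> z)"
    by (simp add: min.assoc)
  show "x \<curlyvee>\<^bsub>crl\<^esub> y \<curlyvee>\<^bsub>crl\<^esub> z = x \<curlyvee>\<^bsub>crl\<^esub> (y \<curlyvee>\<^bsub>crl\<^esub> z)"
    using assoc xy' z' by simp
  show "x \<otimes>\<^bsub>crl\<^esub> y \<preceq>\<^bsub>crl\<^esub> z \<longleftrightarrow> y \<preceq>\<^bsub>crl\<^esub> x \<rightharpoonup>\<^bsub>crl\<^esub> z"
    using le_crl[of "min x y" z] le_crl[of y "x \<rightharpoonup>\<^bsub>crl\<^esub> z"] res_crl[of x z] xy' z' by simp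
  have xyz: "x \<curlywedge>\<^bsub>crl\<^esub> y < n" "y \<curlywedge>\<^bsub>crl\<^esub> z < n"
    using m(1) xy' z' by auto
  \<comment> \<open>Each side is a lower bound of all three elements and hence below the
    other.\<close>
  show "x \<curlywedge>\<^bsub>crl\<^esub> y \<curlywedge>\<^bsub>crl\<^esub> z = x \<curlywedge>\<^bsub>crl\<^esub> (y \<curlywedge>\<^bsub>crl\<^esub> z)"
  proof (rule J_antisym)
    let ?l = "x \<curlywedge>\<^bsub>crl\<^esub> y \<curlywedge>\<^bsub>crl\<^esub> z" and ?r = "x \<curlywedge>\<^bsub>crl\<^esub> (y \<curlywedge>\<^bsub>crl\<^esub> z)"
    show lr: "?l < n" "?r < n"
      using m(1) xy' z' xyz by auto
    have "J ?l x = x" "J ?l y = y" "J ?l z = z"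
      using J_le_trans[OF lr(1) xyz(1), of x] J_le_trans[OF lr(1) xyz(1), of y]
        m(2,3)[OF xyz(1) z'] m(2,3)[OF xy'] xy' by auto
    then show "J ?l ?r = ?r"
      using m(4)[OF xy'(1) xyz(2) lr(1)] m(4)[OF xy'(2) z' lr(1)] by simp
    have "J ?r x = x" "J ?r y = y" "J ?r z = z"
      using J_le_trans[OF lr(2) xyz(2), of y] J_le_trans[OF lr(2) xyz(2), of z]
        m(2,3)[OF xy'(1) xyz(2)] m(2,3)[OF xy'(2) z'] xy' z' by auto
    then show "J ?r ?l = ?l"
      using m(4)[OF xyz(1) z' lr(2)] m(4)[OF xy' lr(2)] by simp
  qed
qed

lemma crl_in_conservative_crls: "crl \<in> conservative_crls n"
  using conservative_crl_crl by (simp add: conservative_crls_def) (simp add: crl_def)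

end

section \<open>Residuated lattices\<close>

context comm_residuated_lattice
begin

lemma le_iff_join:
  assumes "x \<in> carrier A" "y \<in> carrier A"
  shows "x \<preceq> y \<longleftrightarrow> x \<curlyvee> y = y"
proof
  assume "x \<preceq> y"
  then show "x \<curlyvee> y = y"
    using join_meet_absorb[of y x] assms by (simp add: crl_le_def meet_comm[of y x] join_comm[of y x])
next
  assume "x \<curlyvee> y = y"
  then show "x \<preceq> y"
    using meet_join_absorb[of x y] assms by (simp add: crl_le_def)
qed

lemma join_idem: "x \<in> carrier A \<Longrightarrow> x \<curlyvee> x = x"
  using meet_join_absorb join_meet_absorb join_closed by metis

lemma le_refl: "x \<in> carrier A \<Longrightarrow> x \<preceq> x"
  by (simp add: le_iff_join join_idem)

lemma le_trans:
  "\<lbrakk>x \<in> carrier A; y \<in> carrier A; z \<in> carrier A; x \<preceq> y; y \<preceq> z\<rbrakk> \<Longrightarrow> x \<preceq> z"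
  unfolding crl_le_def using meet_assoc by metis

lemma le_antisym: "\<lbrakk>x \<in> carrier A; y \<in> carrier A; x \<preceq> y; y \<preceq> x\<rbrakk> \<Longrightarrow> x = y"
  unfolding crl_le_def using meet_comm by metis

lemma join_upper:
  assumes "x \<in> carrier A" "y \<in> carrier A"
  shows "x \<preceq> x \<curlyvee> y" "y \<preceq> x \<curlyvee> y"
  unfolding crl_le_def using meet_join_absorb[of x y] meet_join_absorb[of y x] join_comm assms by auto

lemma join_least:
  "\<lbrakk>x \<in> carrier A; y \<in> carrier A; z \<in> carrier A; x \<preceq> z; y \<preceq> z\<rbrakk> \<Longrightarrow> x \<curlyvee> y \<preceq> z"
  by (simp add: le_iff_join join_closed join_assoc)

lemma meet_lower:
  assumes "x \<in> carrier A" "y \<in> carrier A"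
  shows "x \<curlywedge> y \<preceq> x" "x \<curlywedge> y \<preceq> y"
proof -
  have idem: "z \<curlywedge> z = z" if "z \<in> carrier A" for z
    using le_refl that by (simp add: crl_le_def)
  show "x \<curlywedge> y \<preceq> y"
    unfolding crl_le_def using assms meet_assoc[of x y y] idem by simp
  show "x \<curlywedge> y \<preceq> x"
    unfolding crl_le_def using assms meet_assoc[of y x x] idem meet_comm by simp
qed

lemma meet_greatest:
  "\<lbrakk>x \<in> carrier A; y \<in> carrier A; z \<in> carrier A; z \<preceq> x; z \<preceq> y\<rbrakk> \<Longrightarrow> z \<preceq> x \<curlywedge> y"
  unfolding crl_le_def using meet_assoc by metis

text \<open>Residuation gives \<open>z \<preceq> x \<rightharpoonup> x \<otimes> z\<close>; compose
  with \<open>y \<preceq> z\<close> and residuate back.\<close>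

lemma mult_mono:
  assumes "x \<in> carrier A" "y \<in> carrier A" "z \<in> carrier A" "y \<preceq> z"
  shows "x \<otimes> y \<preceq> x \<otimes> z"
  using residuation[of x z "x \<otimes> z"] residuation[of x y "x \<otimes> z"] assms
    le_trans[of y z "x \<rightharpoonup> x \<otimes> z"] le_refl[of "x \<otimes> z"] res_closed by simp

text \<open>Multiplication by \<open>x\<close> is a left adjoint, so it preserves joins.\<close>

lemma mult_join_distrib:
  assumes "x \<in> carrier A" "y \<in> carrier A" "z \<in> carrier A"
  shows "x \<otimes> (y \<curlyvee> z) = x \<otimes> y \<curlyvee> x \<otimes> z"
proof (rule le_antisym)
  let ?w = "x \<otimes> y \<curlyvee> x \<otimes> z"
  have c: "x \<otimes> y \<in> carrier A" "x \<otimes> z \<in> carrier A" "y \<curlyvee> z \<in> carrier A"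
    using assms by (auto simp: join_closed)
  then show w: "?w \<in> carrier A" "x \<otimes> (y \<curlyvee> z) \<in> carrier A"
    using assms by (auto simp: join_closed)
  have "y \<preceq> x \<rightharpoonup> ?w" "z \<preceq> x \<rightharpoonup> ?w"
    using residuation[of x _ ?w] join_upper[OF c(1,2)] assms w by auto
  then have "y \<curlyvee> z \<preceq> x \<rightharpoonup> ?w"
    using join_least assms w res_closed by simp
  then show "x \<otimes> (y \<curlyvee> z) \<preceq> ?w"
    using residuation assms c w by simp
  show "?w \<preceq> x \<otimes> (y \<curlyvee> z)"
    using mult_mono join_upper join_least assms c w by simp
qed

lemma finite_has_bottom:
  assumes "finite (carrier A)"
  shows "\<exists>b\<in>carrier A. \<forall>x\<in>carrier A. b \<preceq> x"
proof -
  have "\<exists>b\<in>carrier A. \<forall>x\<in>F. b \<preceq> x" if "finite F" "F \<subseteq> carrier A" for F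
    using that
  proof (induction F rule: finite_induct)
    case empty
    then show ?case using one_closed by auto
  next
    case (insert x F)
    then obtain b where b: "b \<in> carrier A" "\<forall>y\<in>F. b \<preceq> y" by auto
    have "x \<curlywedge> b \<preceq> y" if "y \<in> F" for y
      using le_trans[of "x \<curlywedge> b" b y] b that insert.prems meet_closed meet_lower by auto
    then show ?case
      using b insert.prems meet_closed meet_lower by (intro bexI[of _ "x \<curlywedge> b"]) auto
  qed
  then show ?thesis using assms by blast
qed

text \<open>The bottom lies below \<open>x \<rightharpoonup> b\<close>, and residuation turns this
  into \<open>x \<otimes> b \<preceq> b\<close>.\<close>

lemma mult_bottom:
  assumes "b \<in> carrier A" "\<And>x. x \<in> carrier A \<Longrightarrow> b \<preceq> x" "x \<in> carrier A"
  shows "x \<otimes> b = b"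
  using residuation[of x b b] assms res_closed le_antisym by simp

end

text \<open>
  The meet and the residual are determined by the order, hence by the join and the product.
\<close>

lemma crl_isoI:
  fixes A (structure) and B
  assumes A: "comm_residuated_lattice A" and B: "comm_residuated_lattice B"
    and h: "bij_betw h (carrier A) (carrier B)"
    and mult: "\<And>x y. \<lbrakk>x \<in> carrier A; y \<in> carrier A\<rbrakk> \<Longrightarrow> h (x \<otimes> y) = h x \<otimes>\<^bsub>B\<^esub> h y"
    and join: "\<And>x y. \<lbrakk>x \<in> carrier A; y \<in> carrier A\<rbrakk> \<Longrightarrow> h (x \<curlyvee> y) = h x \<curlyvee>\<^bsub>B\<^esub> h y"
  shows "h \<in> crl_iso A B"
proof -
  interpret A: comm_residuated_lattice A by (rule A)
  interpret B: comm_residuated_lattice B by (rule B)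
  have hc: "h x \<in> carrier B" if "x \<in> carrier A" for x
    using h that by (auto simp: bij_betw_def)
  have inj: "h x = h y \<longleftrightarrow> x = y" if "x \<in> carrier A" "y \<in> carrier A" for x y
    using h that by (auto simp: bij_betw_def inj_on_eq_iff)
  have sur: "\<exists>x\<in>carrier A. y = h x" if "y \<in> carrier B" for y
    using h that by (auto simp: bij_betw_def)
  have le: "h x \<preceq>\<^bsub>B\<^esub> h y \<longleftrightarrow> x \<preceq> y" if "x \<in> carrier A" "y \<in> carrier A" for x y
    using that inj[of "x \<curlyvee> y" y]
    by (simp add: A.le_iff_join B.le_iff_join hc join[symmetric] A.join_closed)
  have one: "h \<one> = \<one>\<^bsub>B\<^esub>"
  proof -
    \<comment> \<open>Multiplying by a preimage \<open>u\<close> of the unit of \<open>B\<close>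
      shows that \<open>h\<close> sends \<open>u\<close> and the unit of \<open>A\<close> to the
      same element.\<close>
    obtain u where u: "u \<in> carrier A" "\<one>\<^bsub>B\<^esub> = h u"
      using sur[of "\<one>\<^bsub>B\<^esub>"] by auto
    have "h \<one> = h \<one> \<otimes>\<^bsub>B\<^esub> h u" using u(2)[symmetric] hc by simp
    also have "\<dots> = h u" using mult u by (metis A.l_one A.one_closed)
    finally show ?thesis using u by simp
  qed
  have meet: "h (x \<curlywedge> y) = h x \<curlywedge>\<^bsub>B\<^esub> h y" if xy: "x \<in> carrier A" "y \<in> carrier A" for x y
  proof (rule B.le_antisym)
    show c: "h (x \<curlywedge> y) \<in> carrier B" "h x \<curlywedge>\<^bsub>B\<^esub> h y \<in> carrier B"
      using xy by (auto simp: hc A.meet_closed B.meet_closed)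
    show "h (x \<curlywedge> y) \<preceq>\<^bsub>B\<^esub> h x \<curlywedge>\<^bsub>B\<^esub> h y"
      using xy by (intro B.meet_greatest) (auto simp: hc le A.meet_closed A.meet_lower)
    obtain w where w: "w \<in> carrier A" "h x \<curlywedge>\<^bsub>B\<^esub> h y = h w"
      using sur[OF c(2)] by auto
    have "w \<preceq> x" "w \<preceq> y"
      using B.meet_lower[OF hc hc, OF xy] w xy by (simp_all add: le)
    then show "h x \<curlywedge>\<^bsub>B\<^esub> h y \<preceq>\<^bsub>B\<^esub> h (x \<curlywedge> y)"
      using w xy by (simp add: le A.meet_closed A.meet_greatest)
  qed
  have res: "h (x \<rightharpoonup> y) = h x \<rightharpoonup>\<^bsub>B\<^esub> h y" if xy: "x \<in> carrier A" "y \<in> carrier A" for x y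
  proof -
    obtain w where w: "w \<in> carrier A" "h x \<rightharpoonup>\<^bsub>B\<^esub> h y = h w"
      using sur[OF B.res_closed[OF hc hc, OF xy]] by auto
    \<comment> \<open>The residual and \<open>w\<close> have the same elements below them, hence
      coincide.\<close>
    have iff: "z \<preceq> x \<rightharpoonup> y \<longleftrightarrow> z \<preceq> w" if z: "z \<in> carrier A" for z
    proof -
      have "z \<preceq> x \<rightharpoonup> y \<longleftrightarrow> h x \<otimes>\<^bsub>B\<^esub> h z \<preceq>\<^bsub>B\<^esub> h y"
        using xy z by (simp add: A.residuation[symmetric] mult[symmetric] le)
      then show ?thesis
        using xy z w by (simp add: B.residuation hc le)
    qed
    have "x \<rightharpoonup> y = w"
      using A.le_antisym[OF A.res_closed[OF xy] w(1)] iff[OF w(1)] iff[OF A.res_closed[OF xy]] A.le_refl w A.res_closed xy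
      by simp
    then show ?thesis using w by simp
  qed
  show ?thesis
    using h one mult join meet res by (simp add: crl_iso_def)
qed

section \<open>Ranking a conservative algebra by its product\<close>

lemma (in conservative_crl) mult_idem: "x \<in> carrier A \<Longrightarrow> x \<otimes> x = x"
  using conservative by blast

text \<open>Read \<open>x \<otimes> y = x\<close> as an order; conservativity makes it total.
  Elements are numbered by how many strict predecessors they have, and the join is transported along
  this numbering.\<close>

lemma (in conservative_crl) isomorphic_chain:
  assumes fin: "finite (carrier A)" and n: "card (carrier A) = n"
  obtains J where "min_join n J" "crl_isomorphic A (min_join.crl n J)"
proof -
  define D where "D x = {y \<in> carrier A. y \<otimes> x = y \<and> y \<noteq> x}" for x
  define r where "r x = card (D x)" for x
  have D: "finite (D x)" for x using fin by (simp add: D_def)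
  have r_less: "r x < r y" if xy: "x \<in> carrier A" "y \<in> carrier A" "x \<otimes> y = x" "x \<noteq> y" for x y
  proof -
    have "D x \<subset> D y"
    proof
      show "D x \<subseteq> D y"
      proof
        fix z assume z: "z \<in> D x"
        then have "z \<otimes> y = z" using xy m_assoc[of z x y] by (auto simp: D_def)
        moreover have "z \<noteq> y"
          using z xy m_comm[of x y] by (auto simp: D_def)
        ultimately show "z \<in> D y" using z by (simp add: D_def)
      qed
      have "x \<in> D y" "x \<notin> D x" using xy by (auto simp: D_def)
      then show "D x \<noteq> D y" by auto
    qed
    then show ?thesis unfolding r_def by (rule psubset_card_mono[OF D])
  qed
  \<comment> \<open>Conservativity picks one of the factors, and \<open>r_less\<close> shows that it
    is the one of smaller rank.\<close>
  have r_mult: "r (x \<otimes> y) = min (r x) (r y)" if xy: "x \<in> carrier A" "y \<in> carrier A" for x y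
    using conservative[OF xy] r_less[of x y] r_less[of y x] m_comm[OF xy] xy
    by (cases "x = y") (auto simp: mult_idem)
  have inj: "inj_on r (carrier A)"
  proof (rule inj_onI)
    fix x y assume "x \<in> carrier A" "y \<in> carrier A" "r x = r y"
    then show "x = y"
      using conservative[of x y] r_less[of x y] r_less[of y x] m_comm[of x y] by fastforce
  qed
  have "r x < n" if "x \<in> carrier A" for x
  proof -
    have "D x \<subset> carrier A" using that by (auto simp: D_def)
    then show ?thesis unfolding r_def n[symmetric] by (rule psubset_card_mono[OF fin])
  qed
  then have "r ` carrier A \<subseteq> {..<n}" by auto
  then have img: "r ` carrier A = {..<n}"
    using card_image[OF inj] n by (simp add: card_subset_eq)
  then have bij: "bij_betw r (carrier A) {..<n}"
    using inj by (simp add: bij_betw_def)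
  define s where "s = inv_into (carrier A) r"
  have sr: "s (r x) = x" if "x \<in> carrier A" for x
    using inj that by (simp add: s_def)
  have s: "s i \<in> carrier A" "r (s i) = i" if "i < n" for i
    using img that inv_into_into[of i r "carrier A"] f_inv_into_f[of i r "carrier A"]
    by (auto simp: s_def)
  have rn: "r x < n" if "x \<in> carrier A" for x
    using img that by auto
  define J where "J i j = r (s i \<curlyvee> s j)" for i j
  obtain b where b: "b \<in> carrier A" "\<And>x. x \<in> carrier A \<Longrightarrow> b \<preceq> x"
    using finite_has_bottom[OF fin] by auto
  \<comment> \<open>The lattice bottom absorbs every factor, so nothing precedes it in the product
    order and it receives rank 0.\<close>
  have "D b = {}"
    using mult_bottom[OF b] by (auto simp: D_def)
  then have "r b = 0" by (simp add: r_def)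
  then have s0: "s 0 = b" using sr b by metis
  have smin: "s (min i j) = s i \<otimes> s j" if "i < n" "j < n" for i j
    using r_mult[of "s i" "s j"] sr[of "s i \<otimes> s j"] s that by simp
  have mj: "min_join n J"
  proof
    show "0 < n" using rn b by fastforce
    show "J i j < n" "J i j = J j i" if "i < n" "j < n" for i j
      using that s rn join_closed by (auto simp: J_def join_comm)
    show "J (J i j) k = J i (J j k)" if "i < n" "j < n" "k < n" for i j k
      using that s by (simp add: J_def sr join_closed join_assoc)
    show "J i i = i" if "i < n" for i
      using that s by (simp add: J_def join_idem)
    show "J 0 i = i" if "i < n" for i
      using that s s0 b(2)[of "s i"] b(1) by (simp add: J_def le_iff_join)
    show "min i (J j k) = J (min i j) (min i k)" if "i < n" "j < n" "k < n" for i j k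
    proof -
      have "J (min i j) (min i k) = r (s i \<otimes> (s j \<curlyvee> s k))"
        using that s by (simp add: J_def smin mult_join_distrib)
      then show ?thesis
        using that s by (simp add: r_mult join_closed J_def)
    qed
  qed
  have "r \<in> crl_iso A (min_join.crl n J)"
  proof (rule crl_isoI)
    show "comm_residuated_lattice A" ..
    show "comm_residuated_lattice (min_join.crl n J)"
      using min_join.conservative_crl_crl[OF mj] by (simp add: conservative_crl_def)
  qed (use bij r_mult in \<open>simp_all add: min_join.crl_def[OF mj] J_def sr\<close>)
  then show thesis
    using that mj by (auto simp: crl_isomorphic_def)
qed

section \<open>Counting isomorphism classes\<close>

definition forest_join :: "nat list \<Rightarrow> nat \<Rightarrow> nat \<Rightarrow> nat"
  where "forest_join d = nested_join (\<lambda>i. i + d ! i)"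

text \<open>Removing the root matches trees on \<open>m + 1\<close> nodes with forests on
  \<open>m\<close> nodes.\<close>

definition trees :: "nat \<Rightarrow> nat list set"
  where "trees m = Cons m ` forests m"

text \<open>A first entry \<open>m\<close> means that the interval of node 0 covers all nodes, the
  condition \<open>f 0 = n - 1\<close> of \<open>min_join_nested_join\<close>.\<close>

lemma trees_eq: "trees m = {d \<in> forests (Suc m). d ! 0 = m}"
proof (intro equalityI subsetI)
  fix d assume "d \<in> trees m"
  then show "d \<in> {d \<in> forests (Suc m). d ! 0 = m}"
    using Cons_append_in_forests[of _ m "[]" 0] by (auto simp: trees_def forests_0)
next
  fix d assume d: "d \<in> {d \<in> forests (Suc m). d ! 0 = m}"
  then have "d \<in> forests (Suc m)" by simp
  then show "d \<in> trees m"
    by (rule forests_SucE) (use d in \<open>auto simp: trees_def forests_0\<close>)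
qed

lemma min_join_forest_join:
  assumes "d \<in> trees m"
  shows "min_join (Suc m) (forest_join d)"
  unfolding forest_join_def
  using assms by (intro min_join_nested_join) (auto simp: trees_eq forests_def)

text \<open>The joins may differ outside the carrier, so the records are only claimed to be
  isomorphic, by the identity map.\<close>

lemma (in min_join) crl_cong:
  assumes J': "min_join n J'" and eq: "\<And>x y. x < n \<Longrightarrow> y < n \<Longrightarrow> J x y = J' x y"
  shows "crl_isomorphic crl (min_join.crl n J')"
proof -
  have "(\<lambda>x. x) \<in> crl_iso crl (min_join.crl n J')"
  proof (rule crl_isoI)
    show "comm_residuated_lattice crl" "comm_residuated_lattice (min_join.crl n J')"
      using conservative_crl_crl min_join.conservative_crl_crl[OF J'] by (auto simp: conservative_crl_def)
  qed (use eq in \<open>simp_all add: crl_def min_join.crl_def[OF J'] bij_betw_def\<close>)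
  then show ?thesis by (auto simp: crl_isomorphic_def)
qed

lemma min_join_forest:
  assumes "min_join (Suc m) J"
  shows "\<exists>d\<in>trees m. \<forall>x<Suc m. \<forall>y<Suc m. J x y = forest_join d x y"
proof -
  interpret min_join "Suc m" J by fact
  \<comment> \<open>Truncated subtraction loses nothing here, as
    \<open>i \<le> last_desc i\<close>.\<close>
  define d where "d = map (\<lambda>i. last_desc i - i) [0..<Suc m]"
  have d: "i + d ! i = last_desc i" if "i < Suc m" for i
    using last_desc_ge[OF that] that by (simp add: d_def del: upt_Suc)
  have "nested (Suc m) (\<lambda>i. i + d ! i)"
    unfolding nested_def
  proof (intro allI impI)
    fix x assume x: "x < Suc m"
    note D = nestedD[OF nested_last_desc x]
    have "y + d ! y \<le> last_desc x" if "x \<le> y" "y \<le> last_desc x" for y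
      using D(3)[OF that] d[of y] D(2) that by simp
    then show "x \<le> x + d ! x \<and> x + d ! x < Suc m \<and>
      (\<forall>y. x \<le> y \<and> y \<le> x + d ! x \<longrightarrow> y + d ! y \<le> x + d ! x)"
      using D(2) d[OF x] by simp
  qed
  moreover have "d ! 0 = m"
    using d[of 0] last_desc_0 by simp
  ultimately have "d \<in> trees m"
    by (simp add: trees_eq forests_def) (simp add: d_def)
  moreover have "J x y = forest_join d x y" if "x < Suc m" "y < Suc m" for x y
  proof -
    have "min x y < Suc m" using that by (simp add: min_def)
    then show ?thesis
      using J_eq_nested_join[OF that] d by (simp add: forest_join_def nested_join_def)
  qed
  ultimately show ?thesis by blast
qed

text \<open>Smaller numbers are fixed by induction, so the preimage \<open>z\<close> of
  \<open>x\<close> is at least \<open>x\<close>, and preserving \<open>min\<close> gives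
  \<open>h x \<le> x\<close>. A value below \<open>x\<close> would itself be fixed, against
  injectivity.\<close>

lemma min_preserving_bij_eq_id:
  fixes h :: "nat \<Rightarrow> nat"
  assumes h: "bij_betw h {..<n} {..<n}"
    and min: "\<And>x y. x < n \<Longrightarrow> y < n \<Longrightarrow> h (min x y) = min (h x) (h y)"
    and "x < n"
  shows "h x = x"
  using \<open>x < n\<close>
proof (induction x rule: less_induct)
  case (less x)
  have inj: "inj_on h {..<n}" using h by (simp add: bij_betw_def)
  have "x \<in> h ` {..<n}" using h less.prems by (simp add: bij_betw_def)
  then obtain z where z: "z < n" "h z = x" by auto
  have "x \<le> z" using less.IH[of z] z by (cases "z < x") auto
  then have "h x \<le> x" using min[of x z] z less.prems by (simp add: min_def split: if_splits)
  moreover have "\<not> h x < x"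
  proof
    assume lt: "h x < x"
    then have "h (h x) = h x" using less by simp
    then show False using inj_onD[OF inj, of "h x" x] lt less.prems by simp
  qed
  ultimately show ?case by simp
qed

text \<open>An isomorphism preserves \<open>min\<close>, so it is the identity and the two joins
  agree on the carrier.\<close>

lemma crl_isomorphic_forest_join:
  assumes d: "d \<in> trees m" and d': "d' \<in> trees m"
    and iso: "crl_isomorphic (min_join.crl (Suc m) (forest_join d)) (min_join.crl (Suc m) (forest_join d'))"
  shows "d = d'"
proof -
  interpret J: min_join "Suc m" "forest_join d" by (rule min_join_forest_join[OF d])
  interpret J': min_join "Suc m" "forest_join d'" by (rule min_join_forest_join[OF d'])
  obtain h where h: "h \<in> crl_iso J.crl J'.crl"
    using iso by (auto simp: crl_isomorphic_def)
  then have "bij_betw h {..<Suc m} {..<Suc m}"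
    and "\<And>x y. x < Suc m \<Longrightarrow> y < Suc m \<Longrightarrow> h (min x y) = min (h x) (h y)"
    by (auto simp: crl_iso_def J.crl_def J'.crl_def)
  then have id: "h x = x" if "x < Suc m" for x
    using min_preserving_bij_eq_id that by blast
  have eq: "forest_join d x y = forest_join d' x y" if "x < Suc m" "y < Suc m" for x y
    using h that id[OF that(1)] id[OF that(2)] id[OF J.closed[OF that]]
    by (auto simp: crl_iso_def J.crl_def J'.crl_def)
  have len: "length d = Suc m" "length d' = Suc m"
    and n: "nested (Suc m) (\<lambda>i. i + d ! i)" "nested (Suc m) (\<lambda>i. i + d' ! i)"
    using d d' by (auto simp: trees_eq forests_def)
  show ?thesis
  proof (rule nth_equalityI)
    fix i assume "i < length d"
    then have i: "i < Suc m" using len by simp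
    \<comment> \<open>Joining with the last node \<open>m\<close> leaves \<open>i + d ! i\<close>
      uncut, so the entry can be read off.\<close>
    then show "d ! i = d' ! i"
      using eq[of i m] nestedD(2)[OF n(1) i] nestedD(2)[OF n(2) i]
      by (simp add: forest_join_def nested_joinI)
  qed (use len in simp)
qed

text \<open>Every class contains exactly one algebra \<open>c d\<close>: ranking finds a tree for
  each class, and rigidity separates the trees.\<close>

lemma num_conservative_crls_Suc: "num_conservative_crls (Suc m) = card (forests m)"
proof -
  let ?R = "crl_iso_rel (Suc m)" and ?X = "conservative_crls (Suc m)"
  define c where "c d = min_join.crl (Suc m) (forest_join d)" for d
  have c: "c d \<in> ?X" if "d \<in> trees m" for d
    unfolding c_def by (rule min_join.crl_in_conservative_crls[OF min_join_forest_join[OF that]])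
  note eqv = equiv_crl_iso_rel[of "Suc m"]
  have "bij_betw (\<lambda>d. ?R `` {c d}) (trees m) (?X // ?R)"
    unfolding bij_betw_def
  proof
    show "inj_on (\<lambda>d. ?R `` {c d}) (trees m)"
    proof (rule inj_onI)
      fix d d' assume d: "d \<in> trees m" "d' \<in> trees m" and eq: "?R `` {c d} = ?R `` {c d'}"
      then have "crl_isomorphic (c d) (c d')"
        using eq_equiv_class_iff[OF eqv c c] by (simp add: crl_iso_rel_def)
      then show "d = d'"
        using crl_isomorphic_forest_join d by (simp add: c_def)
    qed
    show "(\<lambda>d. ?R `` {c d}) ` trees m = ?X // ?R"
    proof (intro equalityI subsetI)
      fix K assume "K \<in> (\<lambda>d. ?R `` {c d}) ` trees m"
      then show "K \<in> ?X // ?R" using c by (auto intro: quotientI)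
    next
      fix K assume "K \<in> ?X // ?R"
      then obtain A where A: "A \<in> ?X" "K = ?R `` {A}" by (auto elim: quotientE)
      then interpret A: conservative_crl A by (simp add: conservative_crls_def)
      obtain J where J: "min_join (Suc m) J" "crl_isomorphic A (min_join.crl (Suc m) J)"
        using A.isomorphic_chain[of "Suc m"] A by (auto simp: conservative_crls_def)
      obtain d where d: "d \<in> trees m" "\<forall>x<Suc m. \<forall>y<Suc m. J x y = forest_join d x y"
        using min_join_forest[OF J(1)] by blast
      have "crl_isomorphic A (c d)"
        unfolding c_def
        by (rule crl_isomorphic_trans[OF J(2)], rule min_join.crl_cong[OF J(1) min_join_forest_join[OF d(1)]])
          (use d in auto)
      then have "(A, c d) \<in> ?R" using A c[OF d(1)] by (simp add: crl_iso_rel_def)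
      then have "K = ?R `` {c d}" using A equiv_class_eq[OF eqv] by simp
      then show "K \<in> (\<lambda>d. ?R `` {c d}) ` trees m" using d by auto
    qed
  qed
  then have "card (trees m) = num_conservative_crls (Suc m)"
    unfolding num_conservative_crls_def by (rule bij_betw_same_card)
  moreover have "card (trees m) = card (forests m)"
    unfolding trees_def by (rule card_image) simp
  ultimately show ?thesis by simp
qed

theorem theorem5p6:
  fixes n :: nat
  assumes "n \<ge> 1"
  shows "real (num_conservative_crls n) = 1 / real n * real ((2 * (n - 1)) choose (n - 1))
    \<and> real (num_conservative_crls n) = catalan (n - 1)"
proof -
  obtain m where n: "n = Suc m" using assms by (cases n) auto
  have "real (num_conservative_crls n) = catalan (n - 1)"
    by (simp add: n num_conservative_crls_Suc card_forests)
  then show ?thesis by (simp add: n catalan_def)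
qed

end
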